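(* Let $n=2^t-1$ with $t>0$. There exists a one-to-one correspondence between the set of binary perfect single-error-correcting codes of length $n$ and the set of integer tilings $T\subseteq\mathbb{Z}^n$ with $\Upsilon_n$ in which every element of $T$ has only even entries.
   Context: A binary perfect (single-error-correcting) code of length $n$ is a set $C\subseteq\mathbb{Z}_2^n$ such that any two distinct codewords differ in at least $3$ positions (Hamming distance at least $3$) and every word of $\mathbb{Z}_2^n$ is at Hamming distance at most $1$ from some codeword. For $X,U\in\mathbb{Z}^n$ let $d_M(X,U)=\sum_i|x_i-u_i|$. Let $\Upsilon_n=\{U\in\mathbb{Z}^n: d_M(X,U)\le1\text{ for some }X\in\{-1,0\}^n\}$. A set $T\subseteq\mathbb{Z}^n$ is an integer tiling with $\Upsilon_n$ if the translates $X+\Upsilon_n$, $X\in T$, partition $\mathbb{Z}^n$. *)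

theory Defs
  imports "HOL-Analysis.Finite_Cartesian_Product" "HOL-Library.Z2" "HOL-Library.Disjoint_Sets"
begin

definition hamming_dist :: "'a ^ 'n \<Rightarrow> 'a ^ 'n \<Rightarrow> nat" where
  "hamming_dist x y = card {i. x $ i \<noteq> y $ i}"

definition manhattan_dist :: "int ^ 'n \<Rightarrow> int ^ 'n \<Rightarrow> int" where
  "manhattan_dist x u = (\<Sum>i\<in>UNIV. \<bar>x $ i - u $ i\<bar>)"

definition perfect_code :: "(bit ^ 'n) set \<Rightarrow> bool" where
  "perfect_code C \<longleftrightarrow>
     (\<forall>c\<in>C. \<forall>d\<in>C. c \<noteq> d \<longrightarrow> 3 \<le> hamming_dist c d) \<and>
     (\<forall>w. \<exists>c\<in>C. hamming_dist w c \<le> 1)"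

definition Upsilon :: "(int ^ 'n) set" where
  "Upsilon = {u. \<exists>x. (\<forall>i. x $ i \<in> {-1, 0}) \<and> manhattan_dist x u \<le> 1}"

text \<open>The translates are treated as a family indexed by \<open>T\<close>, so distinct elements of \<open>T\<close>
  are required to have disjoint translates.\<close>

definition integer_tiling :: "(int ^ 'n) set \<Rightarrow> (int ^ 'n) set \<Rightarrow> bool" where
  "integer_tiling V T \<longleftrightarrow>
     disjoint_family_on (\<lambda>x. (+) x ` V) T \<and> (\<Union>x\<in>T. (+) x ` V) = UNIV"

end

theory Submission
  imports Defs
begin

text \<open>
  Since \<open>\<Upsilon>\<close> consists of the cube \<open>{-1, 0}\<^sup>n\<close> and the points obtained from it by moving one
  coordinate to \<open>-2\<close> or \<open>1\<close>, a point \<open>z\<close> lies in \<open>2 x + \<Upsilon>\<close> iff \<open>x = s\<close> or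
  \<open>x = s + d\<^sub>i e\<^sub>i\<close> for some \<open>i\<close>, where \<open>s = \<lceil>z / 2\<rceil>\<close> and the signs \<open>d\<^sub>i\<close> depend on the parity of \<open>z\<^sub>i\<close>. So \<open>2 S\<close> tiles iff for all
  \<open>s\<close> and all sign vectors \<open>d\<close> exactly one of these \<open>n + 1\<close> points is in \<open>S\<close>. Reduction
  modulo 2 maps them bijectively onto a Hamming ball of radius 1, so the preimage of a code is such
  an \<open>S\<close> iff the code is perfect. Conversely, reversing a single sign \<open>d\<^sub>i\<close> shows that \<open>s + e\<^sub>i \<in> S\<close>
  iff \<open>s - e\<^sub>i \<in> S\<close>; hence \<open>S\<close> is 2-periodic in each direction and is such a preimage.
\<close>

section \<open>Auxiliary facts on unique existence and bounded sums\<close>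

lemma ex1_image_iff:
  assumes "inj_on f A"
  shows "(\<exists>!y. y \<in> f ` A \<and> P y) \<longleftrightarrow> (\<exists>!x. x \<in> A \<and> P (f x))"
proof
  assume "\<exists>!y. y \<in> f ` A \<and> P y"
  then obtain x where x: "x \<in> A" "P (f x)" and uniq: "\<And>y. y \<in> f ` A \<Longrightarrow> P y \<Longrightarrow> y = f x"
    by blast
  show "\<exists>!x. x \<in> A \<and> P (f x)"
    by (rule ex1I[of _ x]) (use x uniq assms in \<open>auto dest: inj_onD\<close>)
next
  assume "\<exists>!x. x \<in> A \<and> P (f x)"
  then show "\<exists>!y. y \<in> f ` A \<and> P y" by blast
qed

text \<open>Serves both metrics: the Hamming distance is a sum of indicators and the Manhattan
  distance a sum of absolute differences, so distance at most 1 becomes a condition on single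
  coordinates.\<close>

lemma sum_nonneg_le_1_iff:
  fixes f :: "'n::finite \<Rightarrow> int"
  assumes "\<And>i. 0 \<le> f i"
  shows "(\<Sum>i\<in>UNIV. f i) \<le> 1 \<longleftrightarrow> (\<exists>i. f i \<le> 1 \<and> (\<forall>j. j \<noteq> i \<longrightarrow> f j = 0))"
proof
  assume le: "(\<Sum>i\<in>UNIV. f i) \<le> 1"
  show "\<exists>i. f i \<le> 1 \<and> (\<forall>j. j \<noteq> i \<longrightarrow> f j = 0)"
  proof (cases "\<exists>i. f i \<noteq> 0")
    case True
    then obtain i where i: "f i \<noteq> 0" by blast
    have split: "(\<Sum>i\<in>UNIV. f i) = f i + (\<Sum>j\<in>UNIV - {i}. f j)"
      by (simp add: sum.remove)
    have rest: "0 \<le> (\<Sum>j\<in>UNIV - {i}. f j)"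
      by (simp add: assms sum_nonneg)
    have "f i \<ge> 1" using assms[of i] i by linarith
    with le split rest have "(\<Sum>j\<in>UNIV - {i}. f j) = 0" "f i \<le> 1" by linarith+
    then show ?thesis
      by (metis DiffI UNIV_I assms finite empty_iff insert_iff sum_nonneg_eq_0_iff)
  qed auto
next
  assume "\<exists>i. f i \<le> 1 \<and> (\<forall>j. j \<noteq> i \<longrightarrow> f j = 0)"
  then obtain i where i: "f i \<le> 1" "\<And>j. j \<noteq> i \<Longrightarrow> f j = 0" by blast
  have "(\<Sum>i\<in>UNIV. f i) = f i + (\<Sum>j\<in>UNIV - {i}. f j)"
    by (simp add: sum.remove)
  then show "(\<Sum>i\<in>UNIV. f i) \<le> 1" using i by simp
qed

section \<open>Hamming distance and perfect codes\<close>

lemma hamming_dist_le_1_iff: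
  fixes x y :: "'a ^ 'n::finite"
  shows "hamming_dist x y \<le> 1 \<longleftrightarrow> (\<exists>i. \<forall>j. j \<noteq> i \<longrightarrow> x $ j = y $ j)"
proof -
  have "int (hamming_dist x y) = (\<Sum>i\<in>UNIV. of_bool (x $ i \<noteq> y $ i))"
    by (simp add: hamming_dist_def)
  then have "hamming_dist x y \<le> 1 \<longleftrightarrow> (\<Sum>i\<in>UNIV. of_bool (x $ i \<noteq> y $ i) :: int) \<le> 1"
    by linarith
  then show ?thesis by (subst (asm) sum_nonneg_le_1_iff) auto
qed

lemma hamming_dist_triangle:
  fixes x y z :: "'a ^ 'n::finite"
  shows "hamming_dist x z \<le> hamming_dist x y + hamming_dist y z"
proof -
  have "card {i. x $ i \<noteq> z $ i} \<le> card ({i. x $ i \<noteq> y $ i} \<union> {i. y $ i \<noteq> z $ i})"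
    by (rule card_mono) auto
  then show ?thesis
    unfolding hamming_dist_def using card_Un_le le_trans by blast
qed

lemma hamming_dist_midpoint:
  fixes c d :: "'a ^ 'n::finite"
  assumes "hamming_dist c d \<le> 2"
  obtains w where "hamming_dist w c \<le> 1" "hamming_dist w d \<le> 1"
proof (cases "c = d")
  case True
  then show ?thesis by (intro that[of c]) (simp_all add: hamming_dist_def)
next
  case False
  then obtain i where i: "c $ i \<noteq> d $ i" by (auto simp: vec_eq_iff)
  \<comment> \<open>Moving \<open>c\<close> to \<open>d\<close> in one coordinate removes one of the
    at most two disagreements.\<close>
  define w where "w = (\<chi> j. if j = i then d $ j else c $ j)"
  have "{j. w $ j \<noteq> d $ j} = {j. c $ j \<noteq> d $ j} - {i}"
    by (auto simp: w_def)
  then have "hamming_dist w d \<le> 1"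
    using assms i by (simp add: hamming_dist_def)
  moreover have "hamming_dist w c \<le> 1"
    unfolding hamming_dist_le_1_iff w_def by auto
  ultimately show ?thesis using that by blast
qed

text \<open>Two codewords within 1 of the same word are at distance at most 2 by the triangle
  inequality; conversely, codewords at distance at most 2 both cover a midpoint.\<close>

lemma perfect_code_iff_unique:
  fixes C :: "(bit ^ 'n::finite) set"
  shows "perfect_code C \<longleftrightarrow> (\<forall>w. \<exists>!c. c \<in> C \<and> hamming_dist w c \<le> 1)"
proof
  assume C: "perfect_code C"
  show "\<forall>w. \<exists>!c. c \<in> C \<and> hamming_dist w c \<le> 1"
  proof
    fix w
    have "c = d" if "c \<in> C" "d \<in> C" "hamming_dist w c \<le> 1" "hamming_dist w d \<le> 1" for c d
    proof (rule ccontr)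
      assume "c \<noteq> d"
      then have "3 \<le> hamming_dist c d" using C that by (auto simp: perfect_code_def)
      moreover have "hamming_dist c w = hamming_dist w c"
        by (simp add: hamming_dist_def eq_commute)
      ultimately show False
        using hamming_dist_triangle[of c d w] that by linarith
    qed
    then show "\<exists>!c. c \<in> C \<and> hamming_dist w c \<le> 1"
      using C by (metis perfect_code_def)
  qed
next
  assume uniq: "\<forall>w. \<exists>!c. c \<in> C \<and> hamming_dist w c \<le> 1"
  have "3 \<le> hamming_dist c d" if "c \<in> C" "d \<in> C" "c \<noteq> d" for c d
  proof (rule ccontr)
    assume "\<not> 3 \<le> hamming_dist c d"
    then have "hamming_dist c d \<le> 2" by simp
    then obtain w where "hamming_dist w c \<le> 1" "hamming_dist w d \<le> 1"
      by (rule hamming_dist_midpoint)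
    then show False using uniq that by blast
  qed
  then show "perfect_code C" using uniq by (auto simp: perfect_code_def)
qed

section \<open>Tilings and the shape of \<open>Upsilon\<close>\<close>

lemma integer_tiling_iff_unique:
  fixes V T :: "(int ^ 'n::finite) set"
  shows "integer_tiling V T \<longleftrightarrow> (\<forall>z. \<exists>!x. x \<in> T \<and> z - x \<in> V)"
proof -
  have mem: "z \<in> (+) x ` V \<longleftrightarrow> z - x \<in> V" for x z :: "int ^ 'n"
    by (force simp: image_iff algebra_simps)
  have "integer_tiling V T \<longleftrightarrow>
      (\<forall>x\<in>T. \<forall>y\<in>T. x \<noteq> y \<longrightarrow> (\<forall>z. \<not> (z - x \<in> V \<and> z - y \<in> V))) \<and> (\<forall>z. \<exists>x\<in>T. z - x \<in> V)"
    unfolding integer_tiling_def disjoint_family_on_def disjoint_iff set_eq_iff UN_iff Int_iff empty_iff UNIV_I mem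
    by blast
  then show ?thesis by blast
qed

lemma mem_Upsilon_iff:
  fixes u :: "int ^ 'n::finite"
  shows "u \<in> Upsilon \<longleftrightarrow> (\<exists>i. u $ i \<in> {-2..1} \<and> (\<forall>j. j \<noteq> i \<longrightarrow> u $ j \<in> {-1, 0}))"
proof -
  have "u \<in> Upsilon \<longleftrightarrow> (\<exists>x. (\<forall>i. x $ i \<in> {-1, 0}) \<and>
      (\<exists>i. \<bar>x $ i - u $ i\<bar> \<le> 1 \<and> (\<forall>j. j \<noteq> i \<longrightarrow> \<bar>x $ j - u $ j\<bar> = 0)))"
    unfolding Upsilon_def manhattan_dist_def by (subst sum_nonneg_le_1_iff) auto
  also have "\<dots> \<longleftrightarrow> (\<exists>i. u $ i \<in> {-2..1} \<and> (\<forall>j. j \<noteq> i \<longrightarrow> u $ j \<in> {-1, 0}))"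
  proof safe
    fix x :: "int ^ 'n" and i
    assume x: "\<forall>i. x $ i \<in> {-1, 0}" and i: "\<bar>x $ i - u $ i\<bar> \<le> 1"
      and eq: "\<forall>j. j \<noteq> i \<longrightarrow> \<bar>x $ j - u $ j\<bar> = 0"
    have x': "x $ j \<in> {-1, 0}" for j using x by blast
    have "u $ i \<in> {-2..1}" using i x'[of i] unfolding insert_iff empty_iff atLeastAtMost_iff by arith
    moreover have "\<forall>j. j \<noteq> i \<longrightarrow> u $ j \<in> {-1, 0}"
      using x' eq by (metis abs_eq_0 eq_iff_diff_eq_0)
    ultimately show "\<exists>i. u $ i \<in> {-2..1} \<and> (\<forall>j. j \<noteq> i \<longrightarrow> u $ j \<in> {-1, 0})" by blast
  next
    fix i
    assume u: "u $ i \<in> {-2..1}" "\<forall>j. j \<noteq> i \<longrightarrow> u $ j \<in> {-1, 0}"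
    \<comment> \<open>Rounding each entry of \<open>u\<close> to the cube sends -2 to -1 and 1 to 0,
      and fixes -1 and 0.\<close>
    define x :: "int ^ 'n" where "x = (\<chi> j. if u $ j < 0 then -1 else 0)"
    have "\<forall>i. x $ i \<in> {-1, 0}" by (simp add: x_def)
    moreover have "\<bar>x $ i - u $ i\<bar> \<le> 1" using u(1) by (auto simp: x_def)
    moreover have "\<forall>j. j \<noteq> i \<longrightarrow> \<bar>x $ j - u $ j\<bar> = 0" using u(2) by (auto simp: x_def)
    ultimately show "\<exists>x. (\<forall>i. x $ i \<in> {-1, 0}) \<and>
      (\<exists>i. \<bar>x $ i - u $ i\<bar> \<le> 1 \<and> (\<forall>j. j \<noteq> i \<longrightarrow> \<bar>x $ j - u $ j\<bar> = 0))" by blast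
  qed
  finally show ?thesis .
qed

section \<open>Halved tilings and signed balls\<close>

definition signs :: "(int ^ 'n) set" where
  "signs = {d. \<forall>i. d $ i \<in> {-1, 1}}"

text \<open>A one-sided ball: of the two neighbours of \<open>s\<close> in each direction,
  \<open>d\<close> selects one. Every choice of \<open>i\<close> also yields the centre, so for
  \<open>d\<close> in \<open>signs\<close> there are n + 1 points, as in a Hamming ball.\<close>

definition signed_ball :: "int ^ 'n \<Rightarrow> int ^ 'n \<Rightarrow> (int ^ 'n) set" where
  "signed_ball s d = {x. \<exists>i. x $ i \<in> {s $ i, s $ i + d $ i} \<and> (\<forall>j. j \<noteq> i \<longrightarrow> x $ j = s $ j)}"

definition signed_tiling :: "(int ^ 'n) set \<Rightarrow> bool" where
  "signed_tiling S \<longleftrightarrow> (\<forall>s. \<forall>d\<in>signs. \<exists>!x. x \<in> S \<and> x \<in> signed_ball s d)"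

definition double :: "int ^ 'n \<Rightarrow> int ^ 'n" where
  "double x = (\<chi> i. 2 * x $ i)"

definition mod2 :: "int ^ 'n \<Rightarrow> bit ^ 'n" where
  "mod2 x = (\<chi> i. of_bool (odd (x $ i)))"

lemma inj_double: "inj double"
  by (auto simp: inj_def double_def vec_eq_iff)

lemma mod2_eq_iff: "mod2 x = mod2 y \<longleftrightarrow> (\<forall>i. even (x $ i) \<longleftrightarrow> even (y $ i))"
  by (auto simp: mod2_def vec_eq_iff)

lemma surj_mod2: "surj mod2"
proof (rule surjI)
  show "mod2 (\<chi> i. of_bool (w $ i = 1)) = w" for w :: "bit ^ 'a"
    by (simp add: mod2_def vec_eq_iff)
qed

lemma diff_double_mem_Upsilon_iff:
  fixes z :: "int ^ 'n::finite"
  shows "z - double x \<in> Upsilon \<longleftrightarrow>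
    x \<in> signed_ball (\<chi> i. (z $ i + 1) div 2) (\<chi> i. if even (z $ i) then 1 else -1)"
proof -
  have centre: "a - 2 * b \<in> {-1, 0} \<longleftrightarrow> b = (a + 1) div 2" for a b :: int
    by auto
  \<comment> \<open>Among -2, ..., 1 only the two values of the parity of \<open>a\<close> can
    occur: 0 and -2 for even \<open>a\<close>, -1 and 1 for odd \<open>a\<close>. The first of each
    pair is the centre, the second fixes the side of the arm.\<close>
  have arm: "a - 2 * b \<in> {-2..1} \<longleftrightarrow>
      b \<in> {(a + 1) div 2, (a + 1) div 2 + (if even a then 1 else -1)}" for a b :: int
    by auto
  show ?thesis
    unfolding mem_Upsilon_iff signed_ball_def mem_Collect_eq double_def vector_minus_component
      vec_lambda_beta centre arm ..
qed

lemma integer_tiling_double_iff: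
  fixes S :: "(int ^ 'n::finite) set"
  shows "integer_tiling Upsilon (double ` S) \<longleftrightarrow> signed_tiling S"
proof -
  have real: "\<exists>z. s = (\<chi> i. (z $ i + 1) div 2) \<and> d = (\<chi> i. if even (z $ i) then 1 else -1)"
    if "d \<in> signs" for s d :: "int ^ 'n"
  proof -
    have d: "d $ i = 1 \<or> d $ i = -1" for i using that by (auto simp: signs_def)
    show ?thesis
      \<comment> \<open>Both \<open>2 * s $ i\<close> and \<open>2 * s $ i - 1\<close> have half
        \<open>s $ i\<close> after rounding up; their parities realise the two signs, independently
        in each coordinate.\<close>
      by (rule exI[of _ "\<chi> i. if d $ i = 1 then 2 * s $ i else 2 * s $ i - 1"])
        (use d in \<open>auto simp: vec_eq_iff\<close>)
  qed
  have sg: "(\<chi> i. if even (z $ i) then 1 else -1) \<in> signs" for z :: "int ^ 'n"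
    by (simp add: signs_def)
  have tiling: "integer_tiling Upsilon (double ` S) \<longleftrightarrow> (\<forall>z. \<exists>!x. x \<in> S \<and>
      x \<in> signed_ball (\<chi> i. (z $ i + 1) div 2) (\<chi> i. if even (z $ i) then 1 else -1))"
    unfolding integer_tiling_iff_unique ex1_image_iff[OF inj_on_subset[OF inj_double subset_UNIV]]
      diff_double_mem_Upsilon_iff ..
  show ?thesis
    unfolding tiling signed_tiling_def
  proof (intro iffI allI ballI)
    fix s d :: "int ^ 'n"
    assume uniq: "\<forall>z. \<exists>!x. x \<in> S \<and>
      x \<in> signed_ball (\<chi> i. (z $ i + 1) div 2) (\<chi> i. if even (z $ i) then 1 else -1)"
      and "d \<in> signs"
    obtain z where "s = (\<chi> i. (z $ i + 1) div 2)" "d = (\<chi> i. if even (z $ i) then 1 else -1)"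
      using real[OF \<open>d \<in> signs\<close>] by blast
    then show "\<exists>!x. x \<in> S \<and> x \<in> signed_ball s d"
      using uniq by (simp only:)
  next
    fix z :: "int ^ 'n"
    assume "\<forall>s. \<forall>d\<in>signs. \<exists>!x. x \<in> S \<and> x \<in> signed_ball s d"
    then show "\<exists>!x. x \<in> S \<and>
      x \<in> signed_ball (\<chi> i. (z $ i + 1) div 2) (\<chi> i. if even (z $ i) then 1 else -1)"
      using sg[of z] by (simp only:)
  qed
qed

section \<open>Reduction modulo 2\<close>

lemma bij_betw_mod2_signed_ball:
  fixes s :: "int ^ 'n::finite"
  assumes "d \<in> signs"
  shows "bij_betw mod2 (signed_ball s d) {c. hamming_dist (mod2 s) c \<le> 1}"
proof (rule bij_betw_imageI)
  have d: "odd (d $ i)" for i using assms by (auto simp: signs_def dest: spec[of _ i])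
  show "inj_on mod2 (signed_ball s d)"
  proof (rule inj_onI)
    fix x y assume x: "x \<in> signed_ball s d" and y: "y \<in> signed_ball s d" and eq: "mod2 x = mod2 y"
    \<comment> \<open>As \<open>d $ i\<close> is odd, the parity of an entry tells whether it was
      moved, so \<open>mod2\<close> determines the point of the ball.\<close>
    have *: "v $ i = (if even (v $ i) \<longleftrightarrow> even (s $ i) then s $ i else s $ i + d $ i)"
      if "v \<in> signed_ball s d" for v i
    proof -
      obtain l where "v $ l \<in> {s $ l, s $ l + d $ l}" "\<And>j. j \<noteq> l \<Longrightarrow> v $ j = s $ j"
        using \<open>v \<in> signed_ball s d\<close> by (auto simp: signed_ball_def)
      then show ?thesis using d[of i] by (cases "i = l") auto
    qed
    show "x = y"
      unfolding vec_eq_iff using *[OF x] *[OF y] eq by (metis mod2_eq_iff)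
  qed
  show "mod2 ` signed_ball s d = {c. hamming_dist (mod2 s) c \<le> 1}"
  proof safe
    fix x assume "x \<in> signed_ball s d"
    then show "hamming_dist (mod2 s) (mod2 x) \<le> 1"
      unfolding hamming_dist_le_1_iff signed_ball_def mod2_def mem_Collect_eq vec_lambda_beta
      by metis
  next
    fix c assume "hamming_dist (mod2 s) c \<le> 1"
    then obtain i where i: "\<And>j. j \<noteq> i \<Longrightarrow> mod2 s $ j = c $ j"
      unfolding hamming_dist_le_1_iff by auto
    define x where
      "x = (\<chi> j. if mod2 s $ j = c $ j then s $ j else s $ j + d $ j)"
    have "x \<in> signed_ball s d" using i by (auto simp: x_def signed_ball_def)
    moreover have "mod2 x = c"
      using d by (auto simp: x_def mod2_def vec_eq_iff)
    ultimately show "c \<in> mod2 ` signed_ball s d" by blast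
  qed
qed

lemma signed_tiling_vimage_mod2_iff:
  fixes C :: "(bit ^ 'n::finite) set"
  shows "signed_tiling (mod2 -` C) \<longleftrightarrow> perfect_code C"
proof -
  have ball: "(\<exists>!x. x \<in> mod2 -` C \<and> x \<in> signed_ball s d) \<longleftrightarrow>
      (\<exists>!c. c \<in> C \<and> hamming_dist (mod2 s) c \<le> 1)" if "d \<in> signs" for s d :: "int ^ 'n"
  proof -
    have inj: "inj_on mod2 (signed_ball s d)"
      and img: "{c. hamming_dist (mod2 s) c \<le> 1} = mod2 ` signed_ball s d"
      using bij_betw_mod2_signed_ball[OF that, of s] by (auto simp: bij_betw_def)
    have "hamming_dist (mod2 s) c \<le> 1 \<longleftrightarrow> c \<in> mod2 ` signed_ball s d" for c
      using img by blast
    then show ?thesis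
      using ex1_image_iff[OF inj, of "\<lambda>c. c \<in> C"] by (simp add: conj_commute)
  qed
  have surj: "(\<forall>s :: int ^ 'n. Q (mod2 s)) \<longleftrightarrow> (\<forall>w. Q w)" for Q
    using surj_mod2 by (metis surjD)
  \<comment> \<open>After the reduction \<open>d\<close> no longer occurs; a nonempty
    \<open>signs\<close> allows dropping its quantifier.\<close>
  have "(\<chi> i. 1) \<in> (signs :: (int ^ 'n) set)" by (simp add: signs_def)
  then have "(signs :: (int ^ 'n) set) \<noteq> {}" by blast
  then have "signed_tiling (mod2 -` C) \<longleftrightarrow>
      (\<forall>s. \<exists>!c. c \<in> C \<and> hamming_dist (mod2 s) c \<le> 1)"
    unfolding signed_tiling_def by (simp only: ball ball_triv ex_in_conv simp_thms cong: ball_cong)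
  also have "\<dots> \<longleftrightarrow> perfect_code C"
    unfolding perfect_code_iff_unique
    by (rule surj)
  finally show ?thesis .
qed

section \<open>Periodicity of signed tilings\<close>

lemma signed_tiling_shift:
  fixes S :: "(int ^ 'n::finite) set"
  assumes S: "signed_tiling S" and x: "x \<in> S" and k: "k \<in> {-1, 1}"
  shows "(\<chi> j. if j = i then x $ j + 2 * k else x $ j) \<in> S"
proof -
  \<comment> \<open>The point \<open>s\<close> is midway between \<open>x\<close> and the target. In
    direction \<open>i\<close> the sign of \<open>d\<close> points back to \<open>x\<close> and that
    of \<open>d'\<close> to the target; elsewhere they agree.\<close>
  define s where "s = (\<chi> j. if j = i then x $ j + k else x $ j)"
  define d :: "int ^ 'n" where "d = (\<chi> j. if j = i then - k else 1)"
  define d' :: "int ^ 'n" where "d' = (\<chi> j. if j = i then k else 1)"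
  have signs: "d \<in> signs" "d' \<in> signs" using k by (auto simp: signs_def d_def d'_def)
  obtain y where y: "y \<in> S" "y \<in> signed_ball s d'"
    using S signs unfolding signed_tiling_def by blast
  obtain l where l: "y $ l \<in> {s $ l, s $ l + d' $ l}" "\<And>j. j \<noteq> l \<Longrightarrow> y $ j = s $ j"
    using y by (auto simp: signed_ball_def)
  have "y \<notin> signed_ball s d"
  proof
    assume "y \<in> signed_ball s d"
    moreover have "x \<in> signed_ball s d"
      by (auto simp: signed_ball_def s_def d_def intro!: exI[of _ i])
    ultimately have "y = x" using S signs x y unfolding signed_tiling_def by blast
    then have "x $ i \<in> {s $ i, s $ i + k}"
      using l by (cases "l = i") (auto simp: d'_def)
    then show False using k by (auto simp: s_def)
  qed
  \<comment> \<open>The two balls share everything but their arms in direction \<open>i\<close>, so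
    \<open>y\<close> must be the end of the arm of \<open>d'\<close>, which is the target.\<close>
  then have "y $ l \<noteq> s $ l" "y $ l \<noteq> s $ l + d $ l"
    using l(2) by (auto simp: signed_ball_def)
  then have "l = i" "y $ l = s $ l + k"
    using l(1) by (auto simp: d_def d'_def split: if_splits)
  then have "y = (\<chi> j. if j = i then x $ j + 2 * k else x $ j)"
    using l(2) by (auto simp: vec_eq_iff s_def)
  then show ?thesis using y by simp
qed

lemma signed_tiling_periodic:
  fixes S :: "(int ^ 'n::finite) set"
  assumes S: "signed_tiling S" and "x \<in> S" and "mod2 x = mod2 y"
  shows "y \<in> S"
  using assms(2,3)
proof (induction "nat (manhattan_dist x y)" arbitrary: x rule: less_induct)
  case less
  show ?case
  proof (cases "x = y")
    case True
    then show ?thesis using less by simp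
  next
    case False
    then obtain i where i: "x $ i \<noteq> y $ i" by (auto simp: vec_eq_iff)
    have ev: "even (x $ i) \<longleftrightarrow> even (y $ i)" using less by (simp add: mod2_eq_iff)
    define k :: int where "k = (if x $ i < y $ i then 1 else -1)"
    define x' where "x' = (\<chi> j. if j = i then x $ j + 2 * k else x $ j)"
    \<comment> \<open>Unequal entries of equal parity differ by at least 2, so a step of 2 towards
      \<open>y $ i\<close> cannot overshoot.\<close>
    have closer: "\<bar>x' $ i - y $ i\<bar> < \<bar>x $ i - y $ i\<bar>"
      using i ev unfolding x'_def k_def by auto presburger+
    have "manhattan_dist x' y < manhattan_dist x y"
      unfolding manhattan_dist_def
      by (rule sum_strict_mono_ex1) (use closer in \<open>auto simp: x'_def\<close>)
    moreover have "manhattan_dist x' y \<ge> 0"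
      by (simp add: manhattan_dist_def sum_nonneg)
    ultimately have "nat (manhattan_dist x' y) < nat (manhattan_dist x y)" by linarith
    moreover have "x' \<in> S"
      unfolding x'_def by (rule signed_tiling_shift) (use S less in \<open>auto simp: k_def\<close>)
    moreover have "mod2 x' = mod2 y"
      using less.prems(2) by (auto simp: mod2_eq_iff x'_def)
    ultimately show ?thesis by (rule less.hyps)
  qed
qed

section \<open>Correspondence between perfect codes and even tilings\<close>

theorem theorem6:
  fixes t :: nat
  assumes "t > 0" and "CARD('n::finite) = 2 ^ t - 1"
  shows "\<exists>\<phi>. bij_betw \<phi> {C :: (bit ^ 'n) set. perfect_code C}
     {T :: (int ^ 'n) set. integer_tiling Upsilon T \<and> (\<forall>x\<in>T. \<forall>i. even (x $ i))}"
proof (rule exI, rule bij_betw_imageI)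
  let ?\<phi> = "\<lambda>C :: (bit ^ 'n) set. double ` (mod2 -` C)"
  show "inj_on ?\<phi> {C. perfect_code C}"
    \<comment> \<open>Injectivity of \<open>double\<close> recovers the preimage, and surjectivity
      of \<open>mod2\<close> recovers the code from it.\<close>
    by (intro inj_onI) (metis inj_double surj_mod2 inj_image_eq_iff surj_image_vimage_eq)
  show "?\<phi> ` {C. perfect_code C} =
    {T. integer_tiling Upsilon T \<and> (\<forall>x\<in>T. \<forall>i. even (x $ i))}"
  proof (intro subset_antisym subsetI)
    fix T assume "T \<in> ?\<phi> ` {C. perfect_code C}"
    then show "T \<in> {T. integer_tiling Upsilon T \<and> (\<forall>x\<in>T. \<forall>i. even (x $ i))}"
      by (auto simp: integer_tiling_double_iff signed_tiling_vimage_mod2_iff)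
        (simp add: double_def)
  next
    fix T :: "(int ^ 'n) set"
    assume "T \<in> {T. integer_tiling Upsilon T \<and> (\<forall>x\<in>T. \<forall>i. even (x $ i))}"
    then have T: "integer_tiling Upsilon T" and ev: "\<And>x i. x \<in> T \<Longrightarrow> even (x $ i)" by auto
    define S where "S = double -` T"
    have "x \<in> range double" if "x \<in> T" for x
      by (rule range_eqI[of _ _ "\<chi> i. x $ i div 2"])
        (use ev[OF that] in \<open>simp add: double_def vec_eq_iff\<close>)
    then have TS: "T = double ` S" by (auto simp: S_def)
    then have S: "signed_tiling S" using T integer_tiling_double_iff by blast
    then have "S = mod2 -` (mod2 ` S)" by (auto intro: signed_tiling_periodic[OF S _ sym])
    then show "T \<in> ?\<phi> ` {C. perfect_code C}"
      using S TS signed_tiling_vimage_mod2_iff by (metis imageI mem_Collect_eq)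
  qed
qed

end
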